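(* Let $\mathcal{H}$ be a $d$-dimensional complex Hilbert space. For every $X\in\mathcal{L}(\mathcal{H})$ the function $\mathcal{A}\mapsto\langle X|F_s(\mathcal{A})|X\rangle$ is a resource monotone; that is, for all POVMs $\mathcal{A}=\{A_a\}$ and $\mathcal{B}=\{B_b\}$ on $\mathcal{H}$ with $\mathcal{A}\succeq\mathcal{B}$, and all $X\in\mathcal{L}(\mathcal{H})$, $$\langle X|F_s(\mathcal{A})|X\rangle\ \ge\ \langle X|F_s(\mathcal{B})|X\rangle .$$
   Context: $\mathcal{L}(\mathcal{H})$ is the space of linear operators on $\mathcal{H}$ with the Hilbert–Schmidt inner product $\langle A|B\rangle=\mathrm{Tr}[A^\dagger B]$; $|A\rangle$ denotes $A$ regarded as a vector of this Hilbert space. A POVM $\mathcal{A}=\{A_a\}$ on $\mathcal{H}$ is a finite family of nonzero positive semidefinite operators (effects) with $\sum_a A_a=I$. Its scaled frame operator is the linear operator on $\mathcal{L}(\mathcal{H})$ $$F_s(\mathcal{A})=\sum_a\frac{|A_a\rangle\langle A_a|}{\langle A_a|I\rangle},\qquad \text{i.e. } F_s(\mathcal{A})(X)=\sum_a\frac{\mathrm{Tr}[A_aX]}{\mathrm{Tr}[A_a]}A_a,$$ so $\langle X|F_s(\mathcal{A})|X\rangle=\sum_a|\mathrm{Tr}[A_aX]|^2/\mathrm{Tr}[A_a]$. $\mathcal{A}\succeq\mathcal{B}$ means there are numbers $p(b|a)\ge 0$ with $\sum_b p(b|a)=1$ for every $a$ such that $B_b=\sum_a p(b|a)A_a$ for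 every $b$. A real-valued function $\mu$ on POVMs is a resource monotone if $\mathcal{A}\succeq\mathcal{B}$ implies $\mu(\mathcal{A})\ge\mu(\mathcal{B})$. *)

theory Defs
  imports "HOL-Analysis.Analysis"
begin

text \<open>
  The Hilbert space of dimension \<open>CARD('n)\<close> is \<open>complex^'n\<close>, and its linear operators are given by
  their matrices in the standard orthonormal basis. The inner product that the library puts on
  \<open>complex^'n\<close> is the real one, so the sesquilinear ones are introduced here; they are conjugate
  linear in the first argument.
\<close>

type_synonym 'n operator = "complex^'n^'n"

definition cinner :: "complex^'n \<Rightarrow> complex^'n \<Rightarrow> complex" where
  "cinner v w = (\<Sum>i\<in>UNIV. cnj (v $ i) * w $ i)"

definition dagger :: "'n::finite operator \<Rightarrow> 'n operator" where
  "dagger A = map_matrix cnj (transpose A)"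

definition cscale :: "complex \<Rightarrow> 'n::finite operator \<Rightarrow> 'n operator" where
  "cscale c A = map_matrix ((*) c) A"

definition hs_inner :: "'n::finite operator \<Rightarrow> 'n operator \<Rightarrow> complex" where
  "hs_inner A B = trace (dagger A ** B)"

definition ketbra :: "'n::finite operator \<Rightarrow> 'n operator \<Rightarrow> 'n operator \<Rightarrow> 'n operator" where
  "ketbra A B = (\<lambda>X. cscale (hs_inner B X) A)"

text \<open>For a self-adjoint operator \<open>A\<close> the number \<open>\<langle>v|A v\<rangle>\<close> is real.\<close>

definition psd :: "'n::finite operator \<Rightarrow> bool" where
  "psd A \<longleftrightarrow> dagger A = A \<and> (\<forall>v. 0 \<le> Re (cinner v (A *v v)))"

text \<open>
  A family of effects is a label set \<open>I\<close> together with a function \<open>A\<close>, whose values outside \<open>I\<close> are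
  irrelevant.
\<close>

definition povm :: "'a set \<Rightarrow> ('a \<Rightarrow> 'n::finite operator) \<Rightarrow> bool" where
  "povm I A \<longleftrightarrow> finite I \<and> (\<forall>a\<in>I. A a \<noteq> 0 \<and> psd (A a)) \<and> (\<Sum>a\<in>I. A a) = mat 1"

definition scaled_frame_op ::
    "'a set \<Rightarrow> ('a \<Rightarrow> 'n::finite operator) \<Rightarrow> 'n operator \<Rightarrow> 'n operator" where
  "scaled_frame_op I A X =
     (\<Sum>a\<in>I. cscale (1 / hs_inner (A a) (mat 1)) (ketbra (A a) (A a) X))"

text \<open>In \<open>postprocessing I A J B\<close>, the number \<open>p b a\<close> is the conditional probability \<open>p(b|a)\<close>.\<close>

definition postprocessing ::
    "'a set \<Rightarrow> ('a \<Rightarrow> 'n::finite operator) \<Rightarrow> 'b set \<Rightarrow> ('b \<Rightarrow> 'n operator) \<Rightarrow> bool" where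
  "postprocessing I A J B \<longleftrightarrow>
     (\<exists>p :: 'b \<Rightarrow> 'a \<Rightarrow> real.
        (\<forall>a\<in>I. \<forall>b\<in>J. 0 \<le> p b a) \<and>
        (\<forall>a\<in>I. (\<Sum>b\<in>J. p b a) = 1) \<and>
        (\<forall>b\<in>J. B b = (\<Sum>a\<in>I. p b a *\<^sub>R A a)))"

text \<open>
  A single function argument of HOL can only range over POVMs with labels in one type \<open>'i\<close>; two
  label types can always be embedded in their sum.
\<close>

definition resource_monotone ::
    "('i set \<Rightarrow> ('i \<Rightarrow> 'n::finite operator) \<Rightarrow> real) \<Rightarrow> bool" where
  "resource_monotone \<mu> \<longleftrightarrow>
     (\<forall>I A J B. povm I A \<longrightarrow> povm J B \<longrightarrow> postprocessing I A J B \<longrightarrow> \<mu> J B \<le> \<mu> I A)"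

lemma hs_inner_cscale: "hs_inner X (cscale c A) = c * hs_inner X A"
  by (simp add: hs_inner_def cscale_def trace_def matrix_matrix_mult_def sum_distrib_left ac_simps)

lemma hs_inner_sum: "hs_inner X (\<Sum>a\<in>I. F a) = (\<Sum>a\<in>I. hs_inner X (F a))"
  unfolding hs_inner_def trace_def matrix_matrix_mult_def
  by (induction I rule: infinite_finite_induct) (simp_all add: distrib_left sum.distrib)

lemma hs_inner_commute: "hs_inner A B = cnj (hs_inner B A)"
  unfolding hs_inner_def trace_def matrix_matrix_mult_def dagger_def transpose_def
  by (simp add: mult.commute)

lemma hs_inner_self_adjoint: "dagger A = A \<Longrightarrow> hs_inner A B = trace (A ** B)"
  by (simp add: hs_inner_def)

lemma dagger_mat_1: "dagger (mat 1) = mat 1"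
  by (simp add: dagger_def transpose_def mat_def vec_eq_iff)

lemma trace_psd_real:
  assumes "psd A"
  shows "trace A = of_real (Re (trace A))"
proof -
  have "cnj (hs_inner A (mat 1)) = hs_inner A (mat 1)"
    using hs_inner_commute[of "mat 1" A] assms
    by (simp add: hs_inner_def dagger_mat_1 psd_def)
  then have "cnj (trace A) = trace A"
    using assms by (simp add: hs_inner_self_adjoint psd_def)
  then show ?thesis by (metis Reals_cnj_iff of_real_Re)
qed

text \<open>
  The quadratic form of the scaled frame operator of a POVM is real, so that taking its real part
  only changes the type.
\<close>

lemma scaled_frame_form:
  assumes "povm I A"
  shows "hs_inner X (scaled_frame_op I A X) =
           of_real (\<Sum>a\<in>I. (cmod (trace (A a ** X)))\<^sup>2 / Re (trace (A a)))"
proof -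
  have "1 / hs_inner (A a) (mat 1) * (hs_inner (A a) X * hs_inner X (A a)) =
          of_real ((cmod (trace (A a ** X)))\<^sup>2 / Re (trace (A a)))" if "a \<in> I" for a
  proof -
    have p: "psd (A a)" using assms that by (simp add: povm_def)
    have "hs_inner (A a) X * hs_inner X (A a) = of_real ((cmod (hs_inner (A a) X))\<^sup>2)"
      by (metis hs_inner_commute complex_norm_square)
    moreover have "hs_inner (A a) X = trace (A a ** X)"
      using p by (simp add: hs_inner_self_adjoint psd_def)
    moreover have "hs_inner (A a) (mat 1) = of_real (Re (trace (A a)))"
      using p trace_psd_real[OF p] by (simp add: hs_inner_self_adjoint psd_def)
    ultimately show ?thesis by simp
  qed
  then show ?thesis
    by (simp add: scaled_frame_op_def ketbra_def hs_inner_sum hs_inner_cscale)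
qed

end

theory Submission
  imports Defs
begin

text \<open>
  By the Cauchy-Schwarz inequality, \<open>\<bar>z\<bar>\<^sup>2 / t\<close> is subadditive and homogeneous in \<open>(z, t)\<close> for
  \<open>t > 0\<close>. Applied to \<open>z = Tr[A\<^sub>a X]\<close>, \<open>t = Tr[A\<^sub>a]\<close> with weights \<open>p(b|a)\<close>, this bounds
  the \<open>b\<close>-th term of the form for \<open>\<B>\<close> by \<open>\<Sum>\<^sub>a p(b|a) \<bar>Tr[A\<^sub>a X]\<bar>\<^sup>2 / Tr[A\<^sub>a]\<close>;
  summing over \<open>b\<close> removes the weights. The traces are positive because a positive semidefinite
  matrix with zero diagonal vanishes.
\<close>

text \<open>A weighted Sedrakyan inequality, with vectors in the numerators. It expresses that the
  perspective \<open>norm z ^ 2 / t\<close> of the squared norm is jointly convex.\<close>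

lemma norm_sum_scaleR_square_le:
  fixes z :: "'a \<Rightarrow> 'b::real_normed_vector" and p t :: "'a \<Rightarrow> real"
  assumes p: "\<And>a. a \<in> I \<Longrightarrow> 0 \<le> p a" and t: "\<And>a. a \<in> I \<Longrightarrow> 0 < t a"
  shows "(norm (\<Sum>a\<in>I. p a *\<^sub>R z a))\<^sup>2 / (\<Sum>a\<in>I. p a * t a) \<le> (\<Sum>a\<in>I. p a * ((norm (z a))\<^sup>2 / t a))"
proof -
  let ?T = "\<Sum>a\<in>I. p a * t a" and ?Q = "\<Sum>a\<in>I. p a * ((norm (z a))\<^sup>2 / t a)"
  have T: "0 \<le> ?T" and Q: "0 \<le> ?Q"
    using p t by (auto intro!: sum_nonneg mult_nonneg_nonneg divide_nonneg_pos simp: less_imp_le)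
  have "norm (\<Sum>a\<in>I. p a *\<^sub>R z a) \<le> (\<Sum>a\<in>I. p a * norm (z a))"
    using norm_sum[of "\<lambda>a. p a *\<^sub>R z a" I] p by simp
  \<comment> \<open>The weight is split so that the squares of the two factors sum to
    \<open>?T\<close> and \<open>?Q\<close>.\<close>
  also have "\<dots> = (\<Sum>a\<in>I. sqrt (p a * t a) * (sqrt (p a / t a) * norm (z a)))"
  proof (rule sum.cong)
    fix a assume a: "a \<in> I"
    have "sqrt (p a * t a) * sqrt (p a / t a) = sqrt ((p a)\<^sup>2)"
      using t[OF a] by (simp add: real_sqrt_mult[symmetric] power2_eq_square)
    then show "p a * norm (z a) = sqrt (p a * t a) * (sqrt (p a / t a) * norm (z a))"
      using p[OF a] by (simp add: mult.assoc[symmetric])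
  qed simp
  finally have "(norm (\<Sum>a\<in>I. p a *\<^sub>R z a))\<^sup>2
      \<le> (\<Sum>a\<in>I. sqrt (p a * t a) * (sqrt (p a / t a) * norm (z a)))\<^sup>2"
    by (rule power_mono) simp
  also have "\<dots> \<le> (\<Sum>a\<in>I. (sqrt (p a * t a))\<^sup>2) * (\<Sum>a\<in>I. (sqrt (p a / t a) * norm (z a))\<^sup>2)"
    by (rule Cauchy_Schwarz_ineq_sum)
  also have "(\<Sum>a\<in>I. (sqrt (p a * t a))\<^sup>2) = ?T"
    by (rule sum.cong) (use p t in \<open>auto simp: less_imp_le\<close>)
  also have "(\<Sum>a\<in>I. (sqrt (p a / t a) * norm (z a))\<^sup>2) = ?Q"
    by (rule sum.cong) (use p t in \<open>auto simp: power_mult_distrib less_imp_le\<close>)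
  finally have "(norm (\<Sum>a\<in>I. p a *\<^sub>R z a))\<^sup>2 \<le> ?T * ?Q" .
  then show ?thesis
    \<comment> \<open>For \<open>?T = 0\<close> the quotient is 0 by the convention on division, and
      \<open>?Q\<close> is nonnegative.\<close>
    using T Q by (cases "?T = 0") (simp_all add: pos_divide_le_eq mult.commute)
qed

lemma cinner_add_left: "cinner (u + v) w = cinner u w + cinner v w"
  by (simp add: cinner_def algebra_simps sum.distrib)

lemma cinner_add_right: "cinner w (u + v) = cinner w u + cinner w v"
  by (simp add: cinner_def algebra_simps sum.distrib)

lemma cinner_axis_matrix_axis: "cinner (axis i a) (A *v axis j b) = cnj a * A $ i $ j * b"
proof -
  have "(A *v axis j b) $ i = A $ i $ j * b"
    by (simp add: matrix_vector_mult_def axis_def if_distrib cong: if_cong)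
  moreover have "cinner (axis i a) w = cnj a * w $ i" for w
    by (simp add: cinner_def axis_def if_distrib if_distribR cong: if_cong)
  ultimately show ?thesis by simp
qed

lemma psd_diag_nonneg:
  assumes "psd A"
  shows "0 \<le> Re (A $ i $ i)"
proof -
  have "0 \<le> Re (cinner (axis i 1) (A *v axis i 1))"
    using assms by (simp add: psd_def)
  then show ?thesis by (simp add: cinner_axis_matrix_axis)
qed

text \<open>Positivity is tested on vectors supported on two coordinates. With a zero diagonal only
  the cross terms survive, and a suitable phase makes them negative unless the off-diagonal entry
  vanishes.\<close>

lemma psd_zero_diag_imp_zero:
  assumes A: "psd A" and diag: "\<And>i. Re (A $ i $ i) = 0"
  shows "A = 0"
proof -
  have herm: "cnj (A $ j $ i) = A $ i $ j" for i j
    using A by (metis (no_types, lifting) psd_def dagger_def map_matrix_def transpose_def vec_lambda_beta)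
  have dz: "A $ i $ i = 0" for i
    using herm[of i i] diag[of i] by (simp add: complex_eq_iff)
  have "A $ i $ j = 0" for i j
  proof -
    \<comment> \<open>This coefficient turns each of the two cross terms into minus the squared
      modulus of \<open>A $ i $ j\<close>.\<close>
    let ?c = "- cnj (A $ i $ j)"
    let ?v = "axis i 1 + axis j ?c"
    have "cinner ?v (A *v ?v) = - 2 * (A $ i $ j * cnj (A $ i $ j))"
      using dz herm[of i j, symmetric]
      by (simp add: matrix_vector_right_distrib cinner_add_left cinner_add_right cinner_axis_matrix_axis)
    moreover have "0 \<le> Re (cinner ?v (A *v ?v))"
      using A by (simp only: psd_def)
    ultimately have "(cmod (A $ i $ j))\<^sup>2 \<le> 0"
      by (simp add: complex_norm_square[symmetric] cmod_power2 power2_eq_square)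
    then show ?thesis by simp
  qed
  then show ?thesis by (simp add: vec_eq_iff)
qed

lemma psd_trace_pos:
  assumes A: "psd A" and "A \<noteq> 0"
  shows "0 < Re (trace A)"
proof -
  obtain i where "Re (A $ i $ i) \<noteq> 0"
    using psd_zero_diag_imp_zero assms by blast
  then have "0 < Re (A $ i $ i)"
    using psd_diag_nonneg[OF A, of i] by simp
  then show ?thesis
    unfolding trace_def Re_sum by (intro sum_pos2[of UNIV i]) (auto intro: psd_diag_nonneg[OF A])
qed

text \<open>Linearity of the trace gives the numerators for \<open>B b\<close> from a general
  \<open>X\<close> and the denominators from \<open>X = mat 1\<close>.\<close>

lemma trace_sum_scaleR_mult:
  fixes A :: "'a \<Rightarrow> 'n::finite operator"
  shows "trace ((\<Sum>a\<in>I. p a *\<^sub>R A a) ** X) = (\<Sum>a\<in>I. p a *\<^sub>R trace (A a ** X))"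
proof -
  have "linear (\<lambda>M::'n operator. trace (M ** X))"
    by (rule linearI)
      (simp_all add: trace_def matrix_matrix_mult_def distrib_right sum.distrib scaleR_sum_right)
  then show ?thesis
    by (subst linear_sum[of "\<lambda>M. trace (M ** X)"]) (simp_all add: linear_cmul[of "\<lambda>M. trace (M ** X)"])
qed

text \<open>The label types of \<open>I\<close> and \<open>J\<close> are independent, so both
  conjuncts of the final theorem are instances.\<close>

lemma scaled_frame_form_mono:
  fixes X :: "'n::finite operator"
  assumes A: "povm I A" and B: "povm J B" and "postprocessing I A J B"
  shows "Re (hs_inner X (scaled_frame_op J B X)) \<le> Re (hs_inner X (scaled_frame_op I A X))"
proof -
  obtain p where p: "\<And>a b. a \<in> I \<Longrightarrow> b \<in> J \<Longrightarrow> 0 \<le> p b a"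
    and p1: "\<And>a. a \<in> I \<Longrightarrow> (\<Sum>b\<in>J. p b a) = 1"
    and Bp: "\<And>b. b \<in> J \<Longrightarrow> B b = (\<Sum>a\<in>I. p b a *\<^sub>R A a)"
    using assms(3) unfolding postprocessing_def by blast
  let ?q = "\<lambda>a. (cmod (trace (A a ** X)))\<^sup>2 / Re (trace (A a))"
  have t: "0 < Re (trace (A a))" if "a \<in> I" for a
    using A that by (auto simp: povm_def intro: psd_trace_pos)
  have "(\<Sum>b\<in>J. (cmod (trace (B b ** X)))\<^sup>2 / Re (trace (B b))) \<le> (\<Sum>b\<in>J. \<Sum>a\<in>I. p b a * ?q a)"
  proof (rule sum_mono)
    fix b assume b: "b \<in> J"
    have "Re (trace (B b)) = (\<Sum>a\<in>I. p b a * Re (trace (A a)))"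
      using trace_sum_scaleR_mult[of "p b" A I "mat 1"] by (simp add: Bp[OF b])
    then show "(cmod (trace (B b ** X)))\<^sup>2 / Re (trace (B b)) \<le> (\<Sum>a\<in>I. p b a * ?q a)"
      using norm_sum_scaleR_square_le[of I "p b" "\<lambda>a. Re (trace (A a))" "\<lambda>a. trace (A a ** X)"] p b t
      by (simp add: Bp[OF b] trace_sum_scaleR_mult)
  qed
  \<comment> \<open>Exchanging the sums collects, for each \<open>a\<close>, the total probability
    of all its outcomes \<open>b\<close>.\<close>
  also have "\<dots> = (\<Sum>a\<in>I. (\<Sum>b\<in>J. p b a) * ?q a)"
    by (simp only: sum_distrib_right sum.swap[of _ I J])
  also have "\<dots> = (\<Sum>a\<in>I. ?q a)"
    by (simp add: p1)
  finally show ?thesis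
    by (simp add: scaled_frame_form[OF A] scaled_frame_form[OF B])
qed

theorem proposition2:
  fixes X :: "'n::finite operator"
  shows "resource_monotone
           (\<lambda>(I :: 'i set) (A :: 'i \<Rightarrow> 'n operator). Re (hs_inner X (scaled_frame_op I A X))) \<and>
         (\<forall>(I :: 'a set) (A :: 'a \<Rightarrow> 'n operator) (J :: 'b set) (B :: 'b \<Rightarrow> 'n operator).
            povm I A \<longrightarrow> povm J B \<longrightarrow> postprocessing I A J B \<longrightarrow>
              Re (hs_inner X (scaled_frame_op I A X)) \<ge> Re (hs_inner X (scaled_frame_op J B X)))"
  unfolding resource_monotone_def by (blast intro: scaled_frame_form_mono)

end
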